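(* Let $k\in\mathbb{N}$ be a constant and $(G_n)_{n\in\mathbb{N}}$ a family of groups with $G_n\le\mathrm{Sym}_n$ such that $[\mathrm{Sym}_n:G_n]\le 2^{nk}$ for all sufficiently large $n$. Then there is no constant $0<c\le 1$ such that for all sufficiently large $n$ there exists $\Delta_n\subseteq[n]$ with $|\Delta_n|\ge cn$ on which $\mathrm{SP}_A(G_n)$ contains only singleton parts (i.e. every element of $\Delta_n$ forms a singleton part of $\mathrm{SP}_A(G_n)$).
   Context: For a finite set $A$ and $G\le\mathrm{Sym}(A)$, an alternating supporting partition of $G$ is a partition $\mathcal{P}$ of $A$ such that $\prod_{P\in\mathcal{P},|P|<5}\mathrm{Sym}(P)\times\prod_{P\in\mathcal{P},|P|\ge5}\mathrm{Alt}(P)\le G$ (each factor acting on its part and fixing all other points). Every such $G$ has a unique coarsest alternating supporting partition (every alternating supporting partition of $G$ refines it), denoted $\mathrm{SP}_A(G)$. *)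

theory Defs
  imports
    Complex_Main
    "HOL-Algebra.Sym_Groups"
    "HOL-Library.Disjoint_Sets"
begin

definition part_group :: "'a set \<Rightarrow> ('a \<Rightarrow> 'a) set"
  where "part_group P =
    (if card P < 5 then {p. p permutes P} else {p. p permutes P \<and> evenperm p})"

text \<open>The product of the groups \<open>part_group P\<close> over the parts of a partition of \<open>A\<close>, as a set
  of permutations of \<open>A\<close>: an element of the product is a family \<open>f\<close> with one component per part,
  and it acts on \<open>A\<close> by letting \<open>f P\<close> act on \<open>P\<close>.\<close>

definition part_group_prod :: "'a set \<Rightarrow> 'a set set \<Rightarrow> ('a \<Rightarrow> 'a) set"
  where "part_group_prod A \<P> =
    {p. (\<exists>f. (\<forall>P\<in>\<P>. f P \<in> part_group P \<and> (\<forall>x\<in>P. p x = f P x))) \<and> (\<forall>x. x \<notin> A \<longrightarrow> p x = x)}"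

definition alt_supporting_partition :: "'a set \<Rightarrow> ('a \<Rightarrow> 'a) set \<Rightarrow> 'a set set \<Rightarrow> bool"
  where "alt_supporting_partition A G \<P> \<longleftrightarrow> partition_on A \<P> \<and> part_group_prod A \<P> \<subseteq> G"

definition coarsest_alt_supporting_partition :: "'a set \<Rightarrow> ('a \<Rightarrow> 'a) set \<Rightarrow> 'a set set \<Rightarrow> bool"
  where "coarsest_alt_supporting_partition A G \<P> \<longleftrightarrow>
    alt_supporting_partition A G \<P> \<and>
    (\<forall>\<Q>. alt_supporting_partition A G \<Q> \<longrightarrow> refines A \<Q> \<P>)"

lemma coarsest_alt_supporting_partition_unique:
  assumes "coarsest_alt_supporting_partition A G \<P>" "coarsest_alt_supporting_partition A G \<Q>"
  shows "\<P> = \<Q>"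
proof (rule refines_asym)
  show "refines A \<P> \<Q>" "refines A \<Q> \<P>"
    using assms by (simp_all add: coarsest_alt_supporting_partition_def)
qed

definition SP_A :: "'a set \<Rightarrow> ('a \<Rightarrow> 'a) set \<Rightarrow> 'a set set"
  where "SP_A A G = (THE \<P>. coarsest_alt_supporting_partition A G \<P>)"

end

theory Submission
  imports Defs
begin

text \<open>Let \<open>D\<close> be a linearly ordered set of points and let \<open>B\<close> be the set of those \<open>x\<close> in \<open>D\<close> that are
  fixed by every element of \<open>G\<close> supported on \<open>{y \<in> D. y \<le> x}\<close>. The largest point moved
  by a nontrivial element of \<open>G \<inter> Sym(B)\<close> could not lie in \<open>B\<close>. So this group is trivial, the elements
  of \<open>Sym(B)\<close> lie in distinct cosets of \<open>G\<close>, and \<open>|B|!\<close> is at most the index of \<open>G\<close>. The same holds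
  for the reversed order. An index of \<open>2^O(n)\<close> therefore makes both exceptional sets \<open>o(n)\<close>.

  For any other \<open>x\<close> there are \<open>g, h\<close> in \<open>G\<close> moving \<open>x\<close> whose supports lie weakly below and weakly
  above \<open>x\<close>; they meet only in \<open>x\<close>, so their commutator is a 3-cycle through \<open>x\<close> and a smaller point
  of \<open>D\<close>. Overlapping sets \<open>P\<close> of size at least 3 with \<open>Alt(P) \<le> G\<close> can be merged, and the least
  element of a maximal such set is exceptional. If all of them had at most 4 points, a fifth of \<open>D\<close>
  would be exceptional. So \<open>Alt(P) \<le> G\<close> for some \<open>P\<close> in \<open>D\<close> with at least 5 points, and \<open>P\<close> lies in a
  single part of the coarsest alternating supporting partition.\<close>

section \<open>Preliminaries on unions, commutators and transpositions\<close>

abbreviation tr :: "'a \<Rightarrow> 'a \<Rightarrow> 'a \<Rightarrow> 'a"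
  where "tr \<equiv> Transposition.transpose"

text \<open>Provides a largest member of \<open>W\<close> through \<open>x\<close>: all sets in
  \<open>F\<close> share the point \<open>x\<close>, so they can be joined one after
  another.\<close>

lemma Union_mem_of_union_closed:
  assumes "finite F" "F \<noteq> {}" "\<And>P. P \<in> F \<Longrightarrow> P \<in> W \<and> x \<in> P"
    and union: "\<And>P Q. P \<in> W \<Longrightarrow> Q \<in> W \<Longrightarrow> x \<in> P \<Longrightarrow> x \<in> Q \<Longrightarrow> P \<union> Q \<in> W"
  shows "\<Union>F \<in> W"
  using assms(1-3)
proof (induction F rule: finite_ne_induct)
  case (insert P F)
  obtain Q where "Q \<in> F" using insert.hyps by blast
  then have "x \<in> \<Union>F" using insert.prems by blast
  then show ?case using insert by (simp add: union)
qed simp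

text \<open>The supports interfere only at \<open>x\<close>. On the way of a point other than
  \<open>x\<close>, \<open>g x\<close> and \<open>h x\<close>, only one of \<open>g\<close> and
  \<open>h\<close> can act, and its inverse cancels it. The remaining points are moved in the cycle
  \<open>x\<close>, \<open>g x\<close>, \<open>h x\<close>.\<close>

lemma commutator_eq_three_cycle:
  assumes g: "g permutes S" and h: "h permutes T" and int: "S \<inter> T = {x}"
    and gx: "g x \<noteq> x" and hx: "h x \<noteq> x"
  shows "g \<circ> h \<circ> inv' g \<circ> inv' h = tr x (h x) \<circ> tr x (g x)"
proof
  fix y
  note [simp] = permutes_inverses[OF g] permutes_inverses[OF h]
  have S: "x \<in> S" "x \<in> T" using int by auto
  have gS: "g x \<in> S" "inv' g x \<in> S" "h x \<in> T" "inv' h x \<in> T"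
    using S permutes_in_image[OF g] permutes_in_image[OF h] permutes_in_image[OF permutes_inv[OF g]]
      permutes_in_image[OF permutes_inv[OF h]] by auto
  have g0: "g y = y" "inv' g y = y" if "y \<notin> S" for y
    using that g permutes_inv[OF g] by (simp_all add: permutes_not_in)
  have h0: "h y = y" "inv' h y = y" if "y \<notin> T" for y
    using that h permutes_inv[OF h] by (simp_all add: permutes_not_in)
  have n1: "g x \<notin> T" "h x \<notin> S" using gS int gx hx by auto
  have ih: "inv' h x \<noteq> x" and ig: "inv' g x \<noteq> x"
    using gx hx permutes_inverses(1)[OF g, of x] permutes_inverses(1)[OF h, of x] by metis+
  have n2: "inv' h x \<notin> S" "inv' g x \<notin> T" using gS int ih ig by auto
  consider "y = x" | "y = g x" | "y = h x" | "y \<noteq> x" "y \<noteq> g x" "y \<noteq> h x" by blast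
  then show "(g \<circ> h \<circ> inv' g \<circ> inv' h) y = (tr x (h x) \<circ> tr x (g x)) y"
  proof cases
    case 1
    have "g x \<noteq> h x" using n1 gS by auto
    then show ?thesis using 1 n2 gx by (simp add: g0)
  next
    case 2
    then show ?thesis using n1 gS by (simp add: g0 h0)
  next
    case 3
    have "g x \<noteq> h x" using n1 gS by auto
    then show ?thesis using 3 n2 hx by (simp add: h0)
  next
    case 4
    then have R: "(tr x (h x) \<circ> tr x (g x)) y = y" by simp
    have a: "inv' h y \<noteq> x" "inv' g y \<noteq> x"
      using 4 permutes_inverses(1)[OF g, of y] permutes_inverses(1)[OF h, of y] by metis+
    show ?thesis
    proof (cases "y \<in> T")
      case True
      then have "inv' h y \<notin> S"
        using a int permutes_in_image[OF permutes_inv[OF h], of y] by auto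
      moreover have "y \<notin> S" using True 4 int by auto
      ultimately show ?thesis using R by (simp add: g0)
    next
      case False
      have "inv' g y \<notin> T"
      proof (cases "y \<in> S")
        case True
        then show ?thesis using a int permutes_in_image[OF permutes_inv[OF g], of y] by auto
      qed (simp add: g0 False)
      then show ?thesis using R False by (simp add: h0)
    qed
  qed
qed

lemma transpose_conj:
  assumes "bij h"
  shows "tr (h a) (h b) = h \<circ> tr a b \<circ> inv' h"
proof -
  have "tr (h a) (h b) \<circ> h = h \<circ> tr a b"
    using assms by (simp add: transpose_comp_eq bij_is_inj)
  then have "tr (h a) (h b) \<circ> (h \<circ> inv' h) = h \<circ> tr a b \<circ> inv' h"
    by (metis comp_assoc)
  then show ?thesis
    using assms by (metis bij_is_surj surj_iff comp_id)
qed

lemma transpose_mem_part_group: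
  assumes "card P < 5" "a \<in> P" "b \<in> P"
  shows "tr a b \<in> part_group P"
  using assms by (simp add: part_group_def permutes_swap_id)

lemma id_mem_part_group: "id \<in> part_group P"
  by (simp add: part_group_def permutes_id)

lemma permutes_of_part_group: "p \<in> part_group P \<Longrightarrow> p permutes P"
  by (auto simp: part_group_def split: if_splits)

section \<open>Sets with alternating group inside \<open>G\<close> and how they merge\<close>

locale perm_subgroup =
  fixes A :: "'a set" and G :: "('a \<Rightarrow> 'a) set"
  assumes fin: "finite A"
    and mem_permutes: "g \<in> G \<Longrightarrow> g permutes A"
    and id_mem: "id \<in> G"
    and comp_mem: "g \<in> G \<Longrightarrow> h \<in> G \<Longrightarrow> g \<circ> h \<in> G"
    and inv_mem: "g \<in> G \<Longrightarrow> inv' g \<in> G"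
begin

text \<open>For finite \<open>P\<close> this says \<open>Alt(P) \<le> G\<close>; equivalently, all transpositions on \<open>P\<close> lie in
  one coset of \<open>G\<close>.\<close>

definition alt_in :: "'a set \<Rightarrow> bool"
  where "alt_in P \<longleftrightarrow> (\<forall>a\<in>P. \<forall>b\<in>P. \<forall>c\<in>P. \<forall>d\<in>P. a \<noteq> b \<longrightarrow> c \<noteq> d \<longrightarrow> tr a b \<circ> tr c d \<in> G)"

lemma alt_inD:
  "alt_in P \<Longrightarrow> a \<in> P \<Longrightarrow> b \<in> P \<Longrightarrow> c \<in> P \<Longrightarrow> d \<in> P \<Longrightarrow> a \<noteq> b \<Longrightarrow> c \<noteq> d \<Longrightarrow> tr a b \<circ> tr c d \<in> G"
  by (simp add: alt_in_def)

text \<open>Transpositions are involutions, so \<open>tr a b \<circ> tr c d \<in> G\<close> means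
  that both lie in the same right coset of \<open>G\<close>. This lemma and the next make that
  relation usable as an equivalence.\<close>

lemma transpose_same_coset_sym:
  assumes "tr a b \<circ> tr c d \<in> G"
  shows "tr c d \<circ> tr a b \<in> G"
proof -
  have "inv' (tr a b \<circ> tr c d) = tr c d \<circ> tr a b"
    by (subst o_inv_distrib) simp_all
  then show ?thesis using inv_mem[OF assms] by simp
qed

lemma transpose_same_coset_trans:
  assumes "tr a b \<circ> tr c d \<in> G" "tr c d \<circ> tr e f \<in> G"
  shows "tr a b \<circ> tr e f \<in> G"
proof -
  have "(tr a b \<circ> tr c d) \<circ> (tr c d \<circ> tr e f) = tr a b \<circ> tr e f"
    by (simp add: fun_eq_iff)
  then show ?thesis using comp_mem[OF assms] by simp
qed

text \<open>Transpositions through \<open>p\<close> suffice: one that avoids \<open>p\<close> is a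
  product of three of them, and composing it with \<open>tr p d\<close> leaves two pairs that are
  covered by the assumption.\<close>

lemma alt_in_of_base:
  assumes p: "p \<in> P" and base: "\<And>a b. a \<in> P \<Longrightarrow> b \<in> P \<Longrightarrow> a \<noteq> p \<Longrightarrow> b \<noteq> p \<Longrightarrow> tr p a \<circ> tr p b \<in> G"
  shows "alt_in P"
proof -
  have one: "tr a b \<circ> tr p d \<in> G" if "a \<in> P" "b \<in> P" "a \<noteq> b" "d \<in> P" "d \<noteq> p" for a b d
  proof -
    consider "a = p" | "b = p" | "a \<noteq> p" "b \<noteq> p" by blast
    then show ?thesis
    proof cases
      case 1 then show ?thesis using base that by auto
    next
      case 2 then show ?thesis using base[of a d] that by (simp add: transpose_commute)
    next
      case 3
      have "tr a b = tr p a \<circ> tr p b \<circ> tr p a"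
        using 3 that by (auto simp: fun_eq_iff Transposition.transpose_def)
      then have "tr a b \<circ> tr p d = (tr p a \<circ> tr p b) \<circ> (tr p a \<circ> tr p d)"
        by (simp add: comp_assoc)
      then show ?thesis using base 3 that comp_mem by presburger
    qed
  qed
  show ?thesis unfolding alt_in_def
  proof (intro ballI impI)
    fix a b c d assume *: "a \<in> P" "b \<in> P" "c \<in> P" "d \<in> P" "a \<noteq> b" "c \<noteq> d"
    \<comment> \<open>At least one of \<open>a\<close> and \<open>b\<close> differs from
      \<open>p\<close>. The transposition \<open>tr p e\<close> serves as the common comparison for
      \<open>tr a b\<close> and \<open>tr c d\<close>.\<close>
    then obtain e where e: "e \<in> P" "e \<noteq> p" by metis
    show "tr a b \<circ> tr c d \<in> G"
      by (rule transpose_same_coset_trans[OF one[of a b e] transpose_same_coset_sym[OF one[of c d e]]])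
        (use * e in auto)
  qed
qed

text \<open>The transposition \<open>tr p q\<close> lives on both sets and so forces their
  transpositions into one common coset.\<close>

lemma alt_in_union_two:
  assumes P: "alt_in P" and Q: "alt_in Q" and p: "p \<in> P" "p \<in> Q" and q: "q \<in> P" "q \<in> Q" and "p \<noteq> q"
  shows "alt_in (P \<union> Q)"
proof (rule alt_in_of_base)
  show "p \<in> P \<union> Q" using p by simp
  have *: "tr p a \<circ> tr p q \<in> G" if "a \<in> P \<union> Q" "a \<noteq> p" for a
    using that alt_inD[OF P, of p a p q] alt_inD[OF Q, of p a p q] p q \<open>p \<noteq> q\<close> by auto
  show "tr p a \<circ> tr p b \<in> G" if "a \<in> P \<union> Q" "b \<in> P \<union> Q" "a \<noteq> p" "b \<noteq> p" for a b
    using * that by (blast intro: transpose_same_coset_trans transpose_same_coset_sym)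
qed

lemma alt_in_image:
  assumes P: "alt_in P" and h: "h \<in> G"
  shows "alt_in (h ` P)"
  unfolding alt_in_def
proof (intro ballI impI)
  fix a' b' c' d' assume "a' \<in> h ` P" "b' \<in> h ` P" "c' \<in> h ` P" "d' \<in> h ` P" and ne: "a' \<noteq> b'" "c' \<noteq> d'"
  then obtain a b c d where
    *: "a \<in> P" "b \<in> P" "c \<in> P" "d \<in> P" "a' = h a" "b' = h b" "c' = h c" "d' = h d"
    by blast
  have bij: "bij h" using mem_permutes[OF h] by (rule permutes_bij)
  have "tr a' b' \<circ> tr c' d' = h \<circ> tr a b \<circ> (inv' h \<circ> h) \<circ> tr c d \<circ> inv' h"
    unfolding * transpose_conj[OF bij] by (simp add: comp_assoc)
  also have "\<dots> = h \<circ> (tr a b \<circ> tr c d) \<circ> inv' h"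
    using bij by (simp add: bij_is_inj comp_assoc)
  also have "\<dots> \<in> G"
    by (intro comp_mem[OF comp_mem[OF h]] inv_mem[OF h] alt_inD[OF P]) (use * ne in auto)
  finally show "tr a' b' \<circ> tr c' d' \<in> G" .
qed

text \<open>A single common point suffices once \<open>G\<close> can move it inside
  \<open>P\<close>: conjugation by \<open>h\<close> carries \<open>Q\<close> to a second point of
  \<open>P\<close>. Asking for \<open>h\<close> rather than for three points in \<open>P\<close>
  also covers a two-point \<open>P\<close> with Sym(P) \<le> G.\<close>

lemma alt_in_union_of_move:
  assumes P: "alt_in P" and Q: "alt_in Q" and p: "p \<in> P" "p \<in> Q" and "3 \<le> card Q"
    and h: "h \<in> G" "h permutes P" "h p \<noteq> p"
  shows "alt_in (P \<union> Q)"
proof (cases "P \<inter> Q = {p}")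
  case False
  then obtain q where "q \<in> P" "q \<in> Q" "q \<noteq> p" using p by blast
  then show ?thesis using alt_in_union_two[OF P Q p] by blast
next
  case True
  \<comment> \<open>\<open>h ` Q\<close> is \<open>Q\<close> with \<open>p\<close> replaced by \<open>h p\<close>, so it shares two points with \<open>Q\<close>.\<close>
  have hp: "h p \<in> P" using h p by (simp add: permutes_in_image)
  have hfix: "h q = q" if "q \<in> Q" "q \<noteq> p" for q
    using that True h(2) by (metis IntI permutes_not_in singletonD)
  have "2 \<le> card (Q - {p})" using \<open>3 \<le> card Q\<close> p by (simp add: card_Diff_singleton)
  then obtain T where "T \<subseteq> Q - {p}" "card T = 2" by (metis obtain_subset_with_card_n)
  then obtain q r where qr: "q \<in> Q" "r \<in> Q" "q \<noteq> p" "r \<noteq> p" "q \<noteq> r"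
    by (auto simp: card_2_iff)
  have im: "q \<in> h ` Q" "r \<in> h ` Q"
    using qr hfix by (metis imageI)+
  have 1: "alt_in (Q \<union> h ` Q)"
    by (rule alt_in_union_two[OF Q alt_in_image[OF Q h(1)], of q r]) (use qr im in auto)
  have "alt_in (P \<union> (Q \<union> h ` Q))"
    by (rule alt_in_union_two[OF P 1, of p "h p"]) (use p hp h in auto)
  moreover have "P \<union> (Q \<union> h ` Q) = P \<union> Q"
  proof -
    have "h q \<in> P \<union> Q" if "q \<in> Q" for q
      using hfix[OF that] hp that by (cases "q = p") auto
    then show ?thesis by blast
  qed
  ultimately show ?thesis by simp
qed

lemma alt_in_move:
  assumes P: "alt_in P" and "p \<in> P" "3 \<le> card P"
  obtains h where "h \<in> G" "h permutes P" "h p \<noteq> p"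
proof -
  have "2 \<le> card (P - {p})" using assms by (simp add: card_Diff_singleton)
  then obtain T where "T \<subseteq> P - {p}" "card T = 2" by (metis obtain_subset_with_card_n)
  then obtain q r where qr: "q \<in> P" "r \<in> P" "q \<noteq> p" "r \<noteq> p" "q \<noteq> r"
    by (auto simp: card_2_iff)
  show thesis
  proof (rule that[of "tr p q \<circ> tr p r"])
    show "tr p q \<circ> tr p r \<in> G" using alt_inD[OF P, of p q p r] qr \<open>p \<in> P\<close> by auto
    show "(tr p q \<circ> tr p r) permutes P"
      using qr \<open>p \<in> P\<close> by (intro permutes_compose permutes_swap_id)
    show "(tr p q \<circ> tr p r) p \<noteq> p" using qr by simp
  qed
qed

lemma alt_in_union:
  assumes "alt_in P" "alt_in Q" "p \<in> P" "p \<in> Q" "3 \<le> card P" "3 \<le> card Q"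
  shows "alt_in (P \<union> Q)"
proof -
  obtain h where "h \<in> G" "h permutes P" "h p \<noteq> p" by (rule alt_in_move[OF assms(1,3,5)])
  then show ?thesis by (rule alt_in_union_of_move[OF assms(1-4,6)])
qed

section \<open>Part groups contained in \<open>G\<close> and their unions\<close>

lemma evenperm_mem_of_alt_in:
  assumes P: "alt_in P" "finite P" and p: "p permutes P"
  shows "(evenperm p \<longrightarrow> p \<in> G) \<and> (\<not> evenperm p \<longrightarrow> (\<forall>a\<in>P. \<forall>b\<in>P. a \<noteq> b \<longrightarrow> tr a b \<circ> p \<in> G))"
  using p P(2)
proof (induction rule: permutes_induct)
  case id
  show ?case using id_mem by (simp add: id_def)
next
  case (swap c d p)
  have "permutation p" using swap P(2) by (auto simp: permutation_permutes)
  \<comment> \<open>Each transposition flips the parity, so the induction has to carry the claim on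
    odd permutations along with the one on even permutations.\<close>
  then have even: "evenperm (tr c d \<circ> p) \<longleftrightarrow> \<not> evenperm p"
    using swap by (simp add: evenperm_comp permutation_swap_id evenperm_swap)
  have "tr a b \<circ> (tr c d \<circ> p) \<in> G" if "evenperm p" "a \<in> P" "b \<in> P" "a \<noteq> b" for a b
    using comp_mem[OF alt_inD[OF P(1), of a b c d], of p] swap that by (simp add: comp_assoc)
  then show ?case using swap.IH swap.hyps even by blast
qed

lemma part_group_subset_of_alt_in:
  assumes "alt_in P" "5 \<le> card P"
  shows "part_group P \<subseteq> G"
proof -
  have "finite P" using assms(2) by (metis card.infinite not_numeral_le_zero)
  then show ?thesis
    using evenperm_mem_of_alt_in[OF assms(1)] assms(2) by (auto simp: part_group_def)
qed

lemma alt_in_of_part_group: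
  assumes "part_group P \<subseteq> G"
  shows "alt_in P"
  unfolding alt_in_def
proof (intro ballI impI)
  fix a b c d assume *: "a \<in> P" "b \<in> P" "c \<in> P" "d \<in> P" "a \<noteq> b" "c \<noteq> d"
  have "(tr a b \<circ> tr c d) permutes P"
    using * by (intro permutes_compose permutes_swap_id)
  moreover have "evenperm (tr a b \<circ> tr c d)"
    using * by (simp add: evenperm_comp permutation_swap_id evenperm_swap)
  ultimately show "tr a b \<circ> tr c d \<in> G"
    using assms by (auto simp: part_group_def split: if_splits)
qed

lemma part_group_subset_of_transpositions:
  assumes "finite P" and tr: "\<And>a b. a \<in> P \<Longrightarrow> b \<in> P \<Longrightarrow> tr a b \<in> G"
  shows "part_group P \<subseteq> G"
proof
  fix p assume "p \<in> part_group P"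
  then have "p permutes P" by (rule permutes_of_part_group)
  then show "p \<in> G"
    using \<open>finite P\<close>
  proof (induction rule: permutes_induct)
    case id
    show ?case by (rule id_mem)
  next
    case (swap a b p)
    then show ?case by (intro comp_mem tr)
  qed
qed

text \<open>Two points are enough here: a small part group contains the transposition itself, and a
  large one contains a 3-cycle.\<close>

lemma part_group_move:
  assumes "part_group P \<subseteq> G" "p \<in> P" "a \<in> P" "a \<noteq> p"
  obtains h where "h \<in> G" "h permutes P" "h p \<noteq> p"
proof (cases "card P < 5")
  case True
  then have "tr p a \<in> G" using assms transpose_mem_part_group[of P p a] by blast
  then show thesis using that[of "tr p a"] assms by (simp add: permutes_swap_id)
next
  case False
  then have "3 \<le> card P" by simp
  then show thesis by (rule alt_in_move[OF alt_in_of_part_group[OF assms(1)] assms(2)]) (rule that)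
qed

text \<open>This closure property is behind the existence of a coarsest partition. Two small sets
  carry full symmetric groups, and their transpositions through \<open>p\<close> generate Sym(P
  \<union> Q). If one set has at least 5 points, so has the union, and only its alternating group is
  required.\<close>

lemma part_group_union:
  assumes P: "part_group P \<subseteq> G" "finite P" and Q: "part_group Q \<subseteq> G" "finite Q"
    and p: "p \<in> P" "p \<in> Q"
  shows "part_group (P \<union> Q) \<subseteq> G"
proof (cases "card P < 5 \<and> card Q < 5")
  case True
  have base: "tr p a \<in> G" if "a \<in> P \<union> Q" for a
    using that True p P(1) Q(1) transpose_mem_part_group[of P p a] transpose_mem_part_group[of Q p a]
    by blast
  show ?thesis
  proof (rule part_group_subset_of_transpositions)
    show "finite (P \<union> Q)" using P Q by simp
    fix a b assume *: "a \<in> P \<union> Q" "b \<in> P \<union> Q"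
    have "tr a b = tr p a \<circ> tr p b \<circ> tr p a" if "a \<noteq> p" "b \<noteq> p" "a \<noteq> b"
      using that by (auto simp: fun_eq_iff Transposition.transpose_def)
    then have "tr a b \<in> G" if "a \<noteq> p" "b \<noteq> p" "a \<noteq> b"
      using that base[OF *(1)] base[OF *(2)] comp_mem by metis
    moreover have "tr a b \<in> G" if "b = p"
      using that base[OF *(1)] by (simp add: transpose_commute)
    ultimately show "tr a b \<in> G"
      using base[OF *(2)] id_mem by (cases "a = b") auto
  qed
next
  case False
  \<comment> \<open>Proved for fresh \<open>P\<close> and \<open>Q\<close> with \<open>Q\<close> the
    large set, so that it can be applied in either order.\<close>
  have *: "part_group (P \<union> Q) \<subseteq> G"
    if P: "part_group P \<subseteq> G" "finite P" and Q: "part_group Q \<subseteq> G" "finite Q"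
      and p: "p \<in> P" "p \<in> Q" and large: "5 \<le> card Q" for P Q
  proof (cases "P = {p}")
    case True
    then show ?thesis using p Q by (simp add: insert_absorb)
  next
    case False
    then obtain a where "a \<in> P" "a \<noteq> p" using p by blast
    then obtain h where h: "h \<in> G" "h permutes P" "h p \<noteq> p"
      by (rule part_group_move[OF P(1) p(1)])
    have "alt_in (P \<union> Q)"
      by (rule alt_in_union_of_move[OF _ _ p _ h])
        (use P Q large in \<open>auto intro: alt_in_of_part_group\<close>)
    moreover have "5 \<le> card (P \<union> Q)"
      using large P Q card_mono[of "P \<union> Q" Q] by simp
    ultimately show ?thesis by (rule part_group_subset_of_alt_in)
  qed
  show ?thesis
    using False *[OF P Q p] *[OF Q P p(2,1)] by (auto simp: Un_commute not_less)
qed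

section \<open>The coarsest alternating supporting partition\<close>

definition supp_class :: "'a \<Rightarrow> 'a set"
  where "supp_class x = \<Union>{P. P \<subseteq> A \<and> part_group P \<subseteq> G \<and> x \<in> P}"

lemma subset_supp_class:
  "P \<subseteq> A \<Longrightarrow> part_group P \<subseteq> G \<Longrightarrow> x \<in> P \<Longrightarrow> P \<subseteq> supp_class x"
  by (auto simp: supp_class_def)

lemma supp_class_subset: "supp_class x \<subseteq> A"
  by (auto simp: supp_class_def)

lemma part_group_singleton: "part_group {x} \<subseteq> G"
  by (rule part_group_subset_of_transpositions) (auto simp: id_mem)

lemma mem_supp_class: "x \<in> A \<Longrightarrow> x \<in> supp_class x"
  using subset_supp_class[of "{x}" x] part_group_singleton by simp

text \<open>The sets that make up the class all contain \<open>x\<close> and are closed under union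
  by \<open>part_group_union\<close>, so their finite union is again one of them, the
  largest.\<close>

lemma part_group_supp_class:
  assumes "x \<in> A"
  shows "part_group (supp_class x) \<subseteq> G"
proof -
  let ?W = "{P. P \<subseteq> A \<and> part_group P \<subseteq> G}"
  have "supp_class x \<in> ?W"
    unfolding supp_class_def
  proof (rule Union_mem_of_union_closed[where x = x])
    show "finite {P. P \<subseteq> A \<and> part_group P \<subseteq> G \<and> x \<in> P}"
      using fin by simp
    show "{P. P \<subseteq> A \<and> part_group P \<subseteq> G \<and> x \<in> P} \<noteq> {}"
      using part_group_singleton[of x] assms by blast
    show "P \<union> Q \<in> ?W" if "P \<in> ?W" "Q \<in> ?W" "x \<in> P" "x \<in> Q" for P Q
      using that part_group_union[of P Q x] finite_subset[OF _ fin] by auto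
  qed auto
  then show ?thesis by simp
qed

lemma supp_class_eq:
  assumes "x \<in> A" "y \<in> supp_class x"
  shows "supp_class y = supp_class x"
proof -
  have "supp_class x \<subseteq> supp_class y"
    using subset_supp_class supp_class_subset part_group_supp_class assms by metis
  moreover from this have "supp_class y \<subseteq> supp_class x"
    using subset_supp_class supp_class_subset part_group_supp_class assms mem_supp_class
    by (metis subsetD)
  ultimately show ?thesis by simp
qed

lemma part_group_prod_subset:
  assumes part: "partition_on A \<P>" and sub: "\<And>P. P \<in> \<P> \<Longrightarrow> part_group P \<subseteq> G"
  shows "part_group_prod A \<P> \<subseteq> G"
proof
  fix p assume "p \<in> part_group_prod A \<P>"
  then obtain f where f: "\<And>P. P \<in> \<P> \<Longrightarrow> f P \<in> part_group P"
    and pf: "\<And>P x. P \<in> \<P> \<Longrightarrow> x \<in> P \<Longrightarrow> p x = f P x" and out: "\<And>x. x \<notin> A \<Longrightarrow> p x = x"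
    unfolding part_group_prod_def by blast
  have perm: "f P permutes P" if "P \<in> \<P>" for P using f[OF that] by (rule permutes_of_part_group)
  \<comment> \<open>This is \<open>p\<close> on the parts in \<open>F\<close> and the identity
    elsewhere. As the parts are disjoint, adding a part amounts to composing with its component;
    taking all parts recovers \<open>p\<close>.\<close>
  have *: "(\<lambda>x. if x \<in> \<Union>F then p x else x) \<in> G" if "finite F" "F \<subseteq> \<P>" for F
    using that
  proof (induction F)
    case empty
    then show ?case using id_mem by (simp add: id_def)
  next
    case (insert P F)
    have disj: "x \<notin> \<Union>F" if "x \<in> P" for x
      using that insert partition_onD2[OF part] by (fastforce simp: disjoint_def)
    have "(\<lambda>x. if x \<in> \<Union>(insert P F) then p x else x) = (\<lambda>x. if x \<in> \<Union>F then p x else x) \<circ> f P"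
    proof
      fix x
      show "(if x \<in> \<Union>(insert P F) then p x else x) = ((\<lambda>x. if x \<in> \<Union>F then p x else x) \<circ> f P) x"
      proof (cases "x \<in> P")
        case True
        then have "f P x \<in> P" using perm insert by (simp add: permutes_in_image)
        then show ?thesis using True disj pf[of P x] insert by auto
      next
        case False
        then have "f P x = x" using permutes_not_in[OF perm] insert.prems by simp
        then show ?thesis using False by auto
      qed
    qed
    then show ?case using insert f[of P] sub[of P] comp_mem by auto
  qed
  have "finite \<P>" using part fin by (metis finite_elements)
  then have "(\<lambda>x. if x \<in> A then p x else x) \<in> G"
    using *[of \<P>] partition_onD1[OF part] by simp
  moreover have "(\<lambda>x. if x \<in> A then p x else x) = p" using out by auto
  ultimately show "p \<in> G" by simp
qed

lemma part_group_subset_prod: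
  assumes part: "partition_on A \<P>" and P: "P \<in> \<P>"
  shows "part_group P \<subseteq> part_group_prod A \<P>"
proof
  fix g assume g: "g \<in> part_group P"
  then have perm: "g permutes P" by (rule permutes_of_part_group)
  have 1: "g x = x" if "x \<notin> P" for x using perm that by (simp add: permutes_not_in)
  have 2: "x \<notin> P" if "R \<in> \<P>" "R \<noteq> P" "x \<in> R" for R x
    using that P partition_onD2[OF part] by (auto simp: disjoint_def)
  have "P \<subseteq> A" using P partition_onD1[OF part] by blast
  then show "g \<in> part_group_prod A \<P>"
    unfolding part_group_prod_def using g 1 2
    by (auto intro!: exI[of _ "\<lambda>R. if R = P then g else id"] simp: id_mem_part_group)
qed

lemma partition_on_supp_classes: "partition_on A (supp_class ` A)"
proof (rule partition_onI)
  show "\<Union>(supp_class ` A) = A"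
    using supp_class_subset mem_supp_class by blast
  show "disjnt P Q" if "P \<in> supp_class ` A" "Q \<in> supp_class ` A" "P \<noteq> Q" for P Q
  proof -
    obtain x y where xy: "x \<in> A" "y \<in> A" "P = supp_class x" "Q = supp_class y" using \<open>P \<in> _\<close> \<open>Q \<in> _\<close> by blast
    then have "z \<notin> Q" if "z \<in> P" for z
      using supp_class_eq[of x z] supp_class_eq[of y z] \<open>P \<noteq> Q\<close> that by auto
    then show ?thesis by (auto simp: disjnt_iff)
  qed
  show "{} \<notin> supp_class ` A" using mem_supp_class by auto
qed

text \<open>The part group of any part of a supporting partition embeds into the product and hence
  into \<open>G\<close>, so the part lies in the class of each of its points. Thus the classes form
  the coarsest partition, and uniqueness resolves the \<open>THE\<close>.\<close>

lemma SP_A_eq: "SP_A A G = supp_class ` A"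
proof -
  have "coarsest_alt_supporting_partition A G (supp_class ` A)"
    unfolding coarsest_alt_supporting_partition_def alt_supporting_partition_def
  proof (intro conjI allI impI; (elim conjE)?)
    show "partition_on A (supp_class ` A)" by (rule partition_on_supp_classes)
    then show "part_group_prod A (supp_class ` A) \<subseteq> G"
      using part_group_supp_class by (intro part_group_prod_subset) auto
    fix \<Q> assume Q: "partition_on A \<Q>" "part_group_prod A \<Q> \<subseteq> G"
    have "\<exists>Y\<in>supp_class ` A. X \<subseteq> Y" if X: "X \<in> \<Q>" for X
    proof -
      have "X \<subseteq> A" "X \<noteq> {}" using X partition_onD1[OF Q(1)] partition_onD3[OF Q(1)] by auto
      then obtain x where "x \<in> X" "x \<in> A" by blast
      moreover have "part_group X \<subseteq> G" using part_group_subset_prod[OF Q(1) X] Q(2) by blast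
      ultimately show ?thesis using subset_supp_class[OF \<open>X \<subseteq> A\<close>] by blast
    qed
    then show "refines A \<Q> (supp_class ` A)"
      using Q(1) partition_on_supp_classes by (simp add: refines_def)
  qed
  then show ?thesis
    unfolding SP_A_def by (intro the_equality coarsest_alt_supporting_partition_unique)
qed

text \<open>From 5 points on, \<open>alt_in P\<close> gives
  \<open>part_group P \<subseteq> G\<close>, which would put \<open>P\<close> inside the class
  \<open>{x}\<close>. Below 5 the part group is the full symmetric group, which
  \<open>alt_in\<close> does not provide.\<close>

lemma singleton_part_not_alt_in:
  assumes "{x} \<in> SP_A A G" "x \<in> P" "P \<subseteq> A" "alt_in P"
  shows "card P < 5"
proof (rule ccontr)
  assume "\<not> card P < 5"
  then have large: "5 \<le> card P" by simp
  obtain y where y: "y \<in> A" "{x} = supp_class y" using assms(1) SP_A_eq by auto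
  then have "supp_class x = {x}" using supp_class_eq[of y x] by auto
  then have "P \<subseteq> {x}"
    using subset_supp_class[OF assms(3) part_group_subset_of_alt_in[OF assms(4) large] assms(2)] by simp
  then have "card P \<le> 1" using card_mono[of "{x}" P] by simp
  then show False using large by simp
qed

section \<open>Exceptional points of a linear order and their number\<close>

lemma trivial_of_fixed_point:
  assumes B: "\<And>X. X \<subseteq> B \<Longrightarrow> X \<noteq> {} \<Longrightarrow> \<exists>x\<in>X. \<forall>g\<in>G. g permutes X \<longrightarrow> g x = x"
    and g: "g \<in> G" "g permutes B"
  shows "g = id"
proof (rule ccontr)
  assume "g \<noteq> id"
  \<comment> \<open>The assumption is applied to the set of moved points, in which \<open>g\<close>
    has no fixed point.\<close>
  let ?X = "{x \<in> B. g x \<noteq> x}"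
  have X: "g permutes ?X"
  proof (rule permutes_superset[OF g(2)])
    show "g x = x" if "x \<in> B - ?X" for x using that by simp
  qed
  have "?X \<noteq> {}" using \<open>g \<noteq> id\<close> permutes_not_in[OF g(2)] by fastforce
  then show False using B[of ?X] X g(1) by blast
qed

end

locale linordered_perm_subgroup = perm_subgroup A G for A :: "'a::linorder set" and G
begin

definition fixed_below :: "'a set \<Rightarrow> 'a set"
  where "fixed_below D = {x \<in> D. \<forall>g\<in>G. g permutes {y \<in> D. y \<le> x} \<longrightarrow> g x = x}"

definition fixed_above :: "'a set \<Rightarrow> 'a set"
  where "fixed_above D = {x \<in> D. \<forall>g\<in>G. g permutes {y \<in> D. x \<le> y} \<longrightarrow> g x = x}"

lemma trivial_on_fixed_below:
  assumes D: "finite D" and g: "g \<in> G" "g permutes fixed_below D"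
  shows "g = id"
proof (rule trivial_of_fixed_point[OF _ g])
  fix X assume X: "X \<subseteq> fixed_below D" "X \<noteq> {}"
  have fin: "finite X" using X D by (auto simp: fixed_below_def intro: finite_subset)
  \<comment> \<open>Whatever permutes \<open>X\<close> also permutes this initial segment of
    \<open>D\<close>, so membership of \<open>Max X\<close> in \<open>fixed_below D\<close> makes it
    a fixed point.\<close>
  have sub: "X \<subseteq> {y \<in> D. y \<le> Max X}" using X fin by (auto simp: fixed_below_def)
  have mem: "Max X \<in> X" using X fin by simp
  then have "\<forall>g\<in>G. g permutes {y \<in> D. y \<le> Max X} \<longrightarrow> g (Max X) = Max X"
    using X(1) unfolding fixed_below_def by blast
  then show "\<exists>x\<in>X. \<forall>g\<in>G. g permutes X \<longrightarrow> g x = x"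
    using mem permutes_subset[OF _ sub] by blast
qed

lemma trivial_on_fixed_above:
  assumes D: "finite D" and g: "g \<in> G" "g permutes fixed_above D"
  shows "g = id"
proof (rule trivial_of_fixed_point[OF _ g])
  fix X assume X: "X \<subseteq> fixed_above D" "X \<noteq> {}"
  have fin: "finite X" using X D by (auto simp: fixed_above_def intro: finite_subset)
  have sub: "X \<subseteq> {y \<in> D. Min X \<le> y}" using X fin by (auto simp: fixed_above_def)
  have mem: "Min X \<in> X" using X fin by simp
  then have "\<forall>g\<in>G. g permutes {y \<in> D. Min X \<le> y} \<longrightarrow> g (Min X) = Min X"
    using X(1) unfolding fixed_above_def by blast
  then show "\<exists>x\<in>X. \<forall>g\<in>G. g permutes X \<longrightarrow> g x = x"
    using mem permutes_subset[OF _ sub] by blast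
qed

text \<open>The points are \<open>x\<close>, \<open>g x\<close> and \<open>h x\<close>, distinct
  because g x < x < h x. The smaller point \<open>a = g x\<close> will show that \<open>x\<close> is
  not least in its class.\<close>

lemma three_cycle_of_not_fixed:
  assumes x: "x \<in> D" "x \<notin> fixed_below D" "x \<notin> fixed_above D"
  obtains P a where "P \<subseteq> D" "alt_in P" "card P = 3" "x \<in> P" "a \<in> P" "a < x"
proof -
  obtain g where g: "g \<in> G" "g permutes {y \<in> D. y \<le> x}" "g x \<noteq> x"
    using x by (auto simp: fixed_below_def)
  obtain h where h: "h \<in> G" "h permutes {y \<in> D. x \<le> y}" "h x \<noteq> x"
    using x by (auto simp: fixed_above_def)
  have gx: "g x \<in> D" "g x < x" using permutes_in_image[OF g(2), of x] g(3) x(1) by auto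
  have hx: "h x \<in> D" "x < h x" using permutes_in_image[OF h(2), of x] h(3) x(1) by auto
  have int: "{y \<in> D. y \<le> x} \<inter> {y \<in> D. x \<le> y} = {x}" using x(1) by auto
  have "g \<circ> h \<circ> inv' g \<circ> inv' h \<in> G" using g(1) h(1) by (intro comp_mem inv_mem)
  then have c: "tr x (h x) \<circ> tr x (g x) \<in> G"
    by (simp only: commutator_eq_three_cycle[OF g(2) h(2) int g(3) h(3)])
  have c': "tr x (g x) \<circ> tr x (h x) \<in> G" by (rule transpose_same_coset_sym[OF c])
  have "alt_in {x, g x, h x}"
  proof (rule alt_in_of_base[of x])
    fix a b assume "a \<in> {x, g x, h x}" "b \<in> {x, g x, h x}" "a \<noteq> x" "b \<noteq> x"
    then have "a = b \<or> a = g x \<and> b = h x \<or> a = h x \<and> b = g x" by auto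
    then show "tr x a \<circ> tr x b \<in> G" using c c' id_mem by (elim disjE) auto
  qed simp
  moreover have "card {x, g x, h x} = 3" using gx hx by (auto simp: card_insert_if)
  ultimately show thesis
    using that[of "{x, g x, h x}" "g x"] gx hx x(1) by simp
qed

text \<open>Each non-exceptional \<open>x\<close> is sent to the least element of the largest set
  \<open>cl x\<close> of \<open>W\<close> through it. The values are exceptional and each is taken
  at most 4 times, so at most 4/5 of \<open>D\<close> is non-exceptional.\<close>

lemma card_le_of_small_alt:
  assumes D: "finite D" and small: "\<And>P. P \<subseteq> D \<Longrightarrow> alt_in P \<Longrightarrow> card P < 5"
  shows "card D \<le> 5 * (card (fixed_below D) + card (fixed_above D))"
proof -
  define J where "J = D - fixed_below D - fixed_above D"
  \<comment> \<open>Sets of at most two points satisfy \<open>alt_in\<close> trivially; the bound 3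
    is what lets overlapping members merge.\<close>
  define W where "W = {P. P \<subseteq> D \<and> alt_in P \<and> 3 \<le> card P}"
  define cl where "cl x = \<Union>{P \<in> W. x \<in> P}" for x
  have JD: "J \<subseteq> D" by (auto simp: J_def)
  have unionW: "P \<union> Q \<in> W" if "P \<in> W" "Q \<in> W" "x \<in> P" "x \<in> Q" for P Q x
  proof -
    have "finite (P \<union> Q)" using that D by (auto simp: W_def intro: finite_subset)
    then have "3 \<le> card (P \<union> Q)" using that card_mono[of "P \<union> Q" P] by (auto simp: W_def)
    then show ?thesis using that alt_in_union[of P Q x] by (auto simp: W_def)
  qed
  have mid: "\<exists>P\<in>W. x \<in> P \<and> (\<exists>a\<in>P. a < x)" if "x \<in> J" for x
  proof -
    have "x \<in> D" "x \<notin> fixed_below D" "x \<notin> fixed_above D" using that by (auto simp: J_def)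
    then obtain P a where "P \<subseteq> D" "alt_in P" "card P = 3" "x \<in> P" "a \<in> P" "a < x"
      by (rule three_cycle_of_not_fixed)
    then show ?thesis by (auto simp: W_def)
  qed
  have clW: "cl x \<in> W" and clx: "x \<in> cl x" if "x \<in> J" for x
  proof -
    show "cl x \<in> W" unfolding cl_def
    proof (rule Union_mem_of_union_closed[where x = x])
      show "finite {P \<in> W. x \<in> P}" using D by (simp add: W_def)
    qed (use mid[OF that] unionW in auto)
    show "x \<in> cl x" using mid[OF that] by (auto simp: cl_def)
  qed
  have absorb: "P \<subseteq> cl x" if "x \<in> J" "P \<in> W" "z \<in> P" "z \<in> cl x" for x P z
  proof -
    have "cl x \<union> P \<in> W" using unionW[OF clW[OF that(1)] that(2) that(4,3)] .
    then show ?thesis using clx[OF that(1)] by (auto simp: cl_def)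
  qed
  have clfin: "finite (cl x)" if "x \<in> J" for x
    using clW[OF that] D by (auto simp: W_def intro: finite_subset)
  have Min_cl: "Min (cl x) \<in> cl x" if "x \<in> J" for x
    using clfin[OF that] clx[OF that] by (intro Min_in) auto
  \<comment> \<open>A minimum in \<open>J\<close> would lie in a member of \<open>W\<close> with a
    smaller point, and \<open>cl x\<close> would absorb that member.\<close>
  have Min_nJ: "Min (cl x) \<in> D - J" if "x \<in> J" for x
  proof
    show "Min (cl x) \<in> D" using Min_cl[OF that] clW[OF that] by (auto simp: W_def)
    show "Min (cl x) \<notin> J"
    proof
      assume "Min (cl x) \<in> J"
      then obtain P a where "P \<in> W" "Min (cl x) \<in> P" "a \<in> P" "a < Min (cl x)"
        using mid by blast
      moreover from this have "a \<in> cl x" using absorb[OF that _ _ Min_cl[OF that]] by blast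
      ultimately show False using Min_le[OF clfin[OF that]] by (metis not_le)
    qed
  qed
  \<comment> \<open>Classes with the same minimum overlap, so the whole fibre lies in one class,
    which has fewer than 5 points.\<close>
  have fibre: "card {x \<in> J. Min (cl x) = y} \<le> 4" for y
  proof (cases "{x \<in> J. Min (cl x) = y} = {}")
    case False
    then obtain x where x: "x \<in> J" "Min (cl x) = y" by blast
    have "{x \<in> J. Min (cl x) = y} \<subseteq> cl x"
    proof
      fix z assume z: "z \<in> {x \<in> J. Min (cl x) = y}"
      then have "cl z \<subseteq> cl x"
        using absorb[OF x(1) clW[of z], of y] Min_cl[of z] Min_cl[of x] x by auto
      then show "z \<in> cl x" using clx[of z] z by auto
    qed
    then have "card {x \<in> J. Min (cl x) = y} \<le> card (cl x)"
      by (rule card_mono[OF clfin[OF x(1)]])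
    also have "\<dots> \<le> 4" using small[of "cl x"] clW[OF x(1)] by (auto simp: W_def)
    finally show ?thesis .
  next
    case True
    then show ?thesis by (simp only: card.empty)
  qed
  have finDJ: "finite (D - J)" using D by simp
  have "J \<subseteq> (\<Union>y\<in>D - J. {x \<in> J. Min (cl x) = y})" using Min_nJ by blast
  then have "card J \<le> card (\<Union>y\<in>D - J. {x \<in> J. Min (cl x) = y})"
    using D JD by (intro card_mono) (auto intro: finite_subset)
  also have "\<dots> \<le> (\<Sum>y\<in>D - J. card {x \<in> J. Min (cl x) = y})"
    by (rule card_UN_le[OF finDJ])
  also have "\<dots> \<le> (\<Sum>y\<in>D - J. 4)" by (intro sum_mono fibre)
  finally have J: "card J \<le> 4 * card (D - J)" by simp
  have "D - J \<subseteq> fixed_below D \<union> fixed_above D" by (auto simp: J_def)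
  moreover have "finite (fixed_below D \<union> fixed_above D)"
    using D by (simp add: fixed_below_def fixed_above_def)
  ultimately have "card (D - J) \<le> card (fixed_below D \<union> fixed_above D)"
    by (intro card_mono)
  also have "\<dots> \<le> card (fixed_below D) + card (fixed_above D)" by (rule card_Un_le)
  finally have "card (D - J) \<le> card (fixed_below D) + card (fixed_above D)" .
  moreover have "card D = card J + card (D - J)"
    using D JD by (metis card_Diff_subset card_mono finite_subset le_add_diff_inverse)
  ultimately show ?thesis using J by simp
qed

end

section \<open>Factorials against the index\<close>

lemma fact_card_le_card_rcosets:
  assumes G: "subgroup G (sym_group n)" and B: "B \<subseteq> {1..n}"
    and triv: "\<And>g. g \<in> G \<Longrightarrow> g permutes B \<Longrightarrow> g = id"
  shows "fact (card B) \<le> card (rcosets\<^bsub>sym_group n\<^esub> G)"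
proof -
  interpret S: group "sym_group n" by (rule sym_group_is_group)
  let ?Sym = "{p. p permutes B}"
  have finB: "finite B" using B by (rule finite_subset) simp
  have carr: "p \<in> carrier (sym_group n)" if "p permutes B" for p
    using that B by (simp add: sym_group_carrier permutes_subset)
  \<comment> \<open>Two permutations of \<open>B\<close> in the same coset differ by an element of
    \<open>G\<close> that permutes \<open>B\<close>, which \<open>triv\<close> makes the
    identity.\<close>
  have "inj_on (\<lambda>p. G #>\<^bsub>sym_group n\<^esub> p) ?Sym"
  proof (rule inj_onI)
    fix p q assume p: "p \<in> ?Sym" and q: "q \<in> ?Sym"
      and eq: "G #>\<^bsub>sym_group n\<^esub> p = G #>\<^bsub>sym_group n\<^esub> q"
    have "p \<in> G #>\<^bsub>sym_group n\<^esub> q" using S.rcos_self[OF _ G, of p] carr p eq by simp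
    then obtain g where g: "g \<in> G" "p = g \<circ> q" by (auto simp: r_coset_def sym_group_mult)
    then have "g = p \<circ> inv' q" using q by (simp add: comp_assoc permutes_inv_o)
    then have "g permutes B" using p q by (simp add: permutes_compose permutes_inv)
    then have "g = id" by (rule triv[OF g(1)])
    then show "p = q" using g(2) by simp
  qed
  then have "card ?Sym = card ((\<lambda>p. G #>\<^bsub>sym_group n\<^esub> p) ` ?Sym)" by (simp add: card_image)
  also have "\<dots> \<le> card (rcosets\<^bsub>sym_group n\<^esub> G)"
  proof (rule card_mono)
    have "finite (carrier (sym_group n))"
      using finite_permutations[of "{1..n}"] by (simp add: sym_group_def)
    then show "finite (rcosets\<^bsub>sym_group n\<^esub> G)" by (simp add: RCOSETS_def)
    show "(\<lambda>p. G #>\<^bsub>sym_group n\<^esub> p) ` ?Sym \<subseteq> rcosets\<^bsub>sym_group n\<^esub> G"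
      using carr by (auto simp: RCOSETS_def)
  qed
  finally show ?thesis using card_permutations[OF refl finB] by simp
qed

lemma linordered_perm_subgroup_sym_group:
  assumes "subgroup G (sym_group n)"
  shows "linordered_perm_subgroup {1..n} G"
proof
  interpret G: subgroup G "sym_group n" by (rule assms)
  show "g permutes {1..n}" if "g \<in> G" for g using G.mem_carrier[OF that] by (simp add: sym_group_carrier)
  show "id \<in> G" using G.one_closed by (simp add: sym_group_one)
  show "g \<circ> h \<in> G" if "g \<in> G" "h \<in> G" for g h using G.m_closed[OF that] by (simp add: sym_group_mult)
  show "inv' g \<in> G" if "g \<in> G" for g
    using G.m_inv_closed[OF that] G.mem_carrier[OF that] by simp
qed simp

text \<open>The factorial of \<open>f\<close> outgrows (2^M)^f for every fixed \<open>M\<close>,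
  because the terms of the exponential series tend to 0. Choosing M \<ge> k/\<epsilon> gives n k
  \<le> M \<epsilon> n \<le> M f. All \<open>f\<close> above the linear bound are allowed since the
  exceptional sets are bounded only from below.\<close>

lemma fact_gt_two_power_linear:
  fixes \<epsilon> :: real
  assumes "0 < \<epsilon>"
  shows "\<forall>\<^sub>F n in sequentially. \<forall>f. \<epsilon> * real n \<le> real f \<longrightarrow> 2 ^ (n * k) < (fact f :: nat)"
proof -
  define M where "M = nat \<lceil>real k / \<epsilon>\<rceil>"
  have M: "real k \<le> M * \<epsilon>"
    using assms real_nat_ceiling_ge[of "real k / \<epsilon>"] unfolding M_def by (simp only: pos_divide_le_eq)
  have "(\<lambda>f. inverse (fact f) * (2 ^ M) ^ f :: real) \<longlonglongrightarrow> 0"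
    by (rule summable_LIMSEQ_zero[OF summable_exp])
  then have "\<forall>\<^sub>F f in sequentially. inverse (fact f) * (2 ^ M) ^ f < (1 :: real)"
    by (rule order_tendstoD) simp
  then obtain F where F: "\<And>f. F \<le> f \<Longrightarrow> inverse (fact f) * (2 ^ M) ^ f < (1 :: real)"
    by (auto simp: eventually_sequentially)
  have "\<forall>\<^sub>F n in sequentially. real F / \<epsilon> \<le> real n"
    using filterlim_real_sequentially by (simp only: filterlim_at_top)
  then show ?thesis
  proof eventually_elim
    case (elim n)
    show ?case
    proof (intro allI impI)
      fix f assume f: "\<epsilon> * real n \<le> real f"
      have "real F \<le> \<epsilon> * real n" using elim assms by (simp add: divide_le_eq mult.commute)
      then have "F \<le> f" using f by linarith
      then have "(2 ^ M) ^ f < (fact f :: real)" using F[of f] by (simp add: field_simps)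
      then have "2 ^ (M * f) < (fact f :: real)" by (simp add: power_mult)
      moreover have "n * k \<le> M * f"
      proof -
        have "real (n * k) \<le> real n * (M * \<epsilon>)" using M by (simp add: mult_left_mono)
        also have "\<dots> = M * (\<epsilon> * real n)" by simp
        also have "\<dots> \<le> M * real f" using f by (intro mult_left_mono) auto
        finally show ?thesis by (metis of_nat_le_iff of_nat_mult)
      qed
      then have "2 ^ (n * k) \<le> (2 ^ (M * f) :: real)" by (simp add: power_increasing)
      ultimately have "2 ^ (n * k) < (fact f :: real)" by linarith
      then have "real (2 ^ (n * k)) < real (fact f)" by (simp only: of_nat_power of_nat_fact of_nat_numeral)
      then show "2 ^ (n * k) < (fact f :: nat)" by (simp only: of_nat_less_iff)
    qed
  qed
qed

theorem theorem8p8: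
  fixes k :: nat and G :: "nat \<Rightarrow> (nat \<Rightarrow> nat) set"
  assumes "\<And>n. subgroup (G n) (sym_group n)"
    and "\<forall>\<^sub>F n in sequentially. card (rcosets\<^bsub>sym_group n\<^esub> (G n)) \<le> 2 ^ (n * k)"
  shows "\<not> (\<exists>c::real. 0 < c \<and> c \<le> 1 \<and>
           (\<forall>\<^sub>F n in sequentially. \<exists>\<Delta>\<subseteq>{1..n}. real (card \<Delta>) \<ge> c * real n \<and>
              (\<forall>x\<in>\<Delta>. {x} \<in> SP_A {1..n} (G n))))"
proof (intro notI; elim exE conjE)
  fix c :: real
  assume "0 < c" and large: "\<forall>\<^sub>F n in sequentially. \<exists>\<Delta>\<subseteq>{1..n}. real (card \<Delta>) \<ge> c * real n \<and>
    (\<forall>x\<in>\<Delta>. {x} \<in> SP_A {1..n} (G n))"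
  \<comment> \<open>A fifth of \<open>D\<close> is exceptional, so one of the two exceptional sets
    has at least a tenth of the c n points of \<open>D\<close>.\<close>
  then have "0 < c / 10" by simp
  from fact_gt_two_power_linear[OF this, of k] large assms(2)
  have "\<forall>\<^sub>F n in sequentially. False"
  proof eventually_elim
    case (elim n)
    then obtain D where D: "D \<subseteq> {1..n}" "c * real n \<le> real (card D)"
      and sing: "\<And>x. x \<in> D \<Longrightarrow> {x} \<in> SP_A {1..n} (G n)" by blast
    interpret linordered_perm_subgroup "{1..n}" "G n"
      by (rule linordered_perm_subgroup_sym_group[OF assms(1)])
    have finD: "finite D" using D(1) by (rule finite_subset) simp
    have "card P < 5" if "P \<subseteq> D" "alt_in P" for P
    proof (cases "P = {}")
      case False
      then obtain x where "x \<in> P" by blast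
      then show ?thesis using that D(1) sing by (intro singleton_part_not_alt_in[of x]) auto
    qed simp
    then have "card D \<le> 5 * (card (fixed_below D) + card (fixed_above D))"
      by (rule card_le_of_small_alt[OF finD])
    then have "real (card D) \<le> 5 * (card (fixed_below D) + card (fixed_above D))"
      using of_nat_mono by fastforce
    then have "c / 10 * real n \<le> card (fixed_below D) \<or> c / 10 * real n \<le> card (fixed_above D)"
      using D(2) by auto
    moreover have "fact (card B) \<le> (2 ^ (n * k) :: nat)"
      if "B = fixed_below D \<or> B = fixed_above D" for B
    proof -
      have "fact (card B) \<le> card (rcosets\<^bsub>sym_group n\<^esub> (G n))"
      proof (rule fact_card_le_card_rcosets[OF assms(1)])
        show "B \<subseteq> {1..n}" using that D(1) by (auto simp: fixed_below_def fixed_above_def)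
        show "g = id" if "g \<in> G n" "g permutes B" for g
          using that \<open>B = _ \<or> _\<close> trivial_on_fixed_below[OF finD] trivial_on_fixed_above[OF finD] by blast
      qed
      then show ?thesis using elim(3) by linarith
    qed
    ultimately show False using elim(1) by (auto simp flip: not_less)
  qed
  then show False by simp
qed

end
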